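(* Let $G$ be a finite bipartite graph with parts $L\sqcup R$, left-regular of degree $d\ge 2$, and let $n=|L|$, $m=|R|$ with $n\ge m$. Then $\alpha_G(2)\le d-\frac12$. Furthermore, if $\alpha_G(2)=d-\frac12$, then for every integer $t$ with $1\le t\le d$ we have $$\alpha_G(t)\le (d-1)+\frac1t .$$
   Context: Graphs are finite and simple, with nonempty parts. A bipartite graph $G$ with parts $L\sqcup R$ (left part $L$, right part $R$) is left-regular of degree $d$ if every vertex of $L$ has exactly $d$ incident edges. For $X\subseteq L$, $N(X)\subseteq R$ is the set of vertices adjacent to at least one vertex of $X$. For an integer $1\le t\le |L|$ the $t$-th expansion constant of $G$ is $$\alpha_G(t):=\min\left\{\frac{|N(X)|}{|X|}: X\subseteq L,\ 0<|X|\le t\right\}.$$ *)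

theory Defs
  imports Complex_Main
begin

text \<open>A finite simple bipartite graph with parts \<open>L\<close> and \<open>R\<close>. An undirected edge is the
  two-element set of its endpoints; \<open>E\<close> being a set of such sets excludes loops and multiple edges.\<close>

definition bipartite_graph :: "'a set \<Rightarrow> 'a set \<Rightarrow> 'a set set \<Rightarrow> bool" where
  "bipartite_graph L R E \<longleftrightarrow>
     finite L \<and> finite R \<and> L \<noteq> {} \<and> R \<noteq> {} \<and> L \<inter> R = {} \<and>
     E \<subseteq> {{u, v} | u v. u \<in> L \<and> v \<in> R}"

definition left_regular :: "'a set \<Rightarrow> 'a set set \<Rightarrow> nat \<Rightarrow> bool" where
  "left_regular L E d \<longleftrightarrow> (\<forall>u\<in>L. card {e \<in> E. u \<in> e} = d)"

definition neighbors :: "'a set \<Rightarrow> 'a set set \<Rightarrow> 'a set \<Rightarrow> 'a set" where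
  "neighbors R E X = {v \<in> R. \<exists>u\<in>X. {u, v} \<in> E}"

text \<open>Meant for finite \<open>L\<close> and \<open>1 \<le> t \<le> card L\<close>; the minimum is then over a finite nonempty set.\<close>

definition expansion_const :: "'a set \<Rightarrow> 'a set \<Rightarrow> 'a set set \<Rightarrow> nat \<Rightarrow> real" where
  "expansion_const L R E t =
     Min {real (card (neighbors R E X)) / real (card X) | X. X \<subseteq> L \<and> 0 < card X \<and> card X \<le> t}"

end

theory Submission
  imports Defs
begin

text \<open>Counting edges from both sides, some \<open>v\<close> in \<open>R\<close> has degree at least \<open>d\<close> because
  \<open>|R| \<le> |L|\<close>. Any \<open>t \<le> d\<close> neighbours of \<open>v\<close> share \<open>v\<close>, so they have at most
  \<open>1 + t (d - 1)\<close> neighbours. This gives the bound \<open>(d - 1) + 1 / t\<close> for every such \<open>t\<close>;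
  the first claim is the case \<open>t = 2\<close>.\<close>

lemma bipartite_graph_finite:
  assumes "bipartite_graph L R E"
  shows "finite L" "finite R" "finite E"
proof -
  show "finite L" "finite R"
    using assms by (auto simp: bipartite_graph_def)
  then have "finite ((\<lambda>(u, v). {u, v}) ` (L \<times> R))"
    by blast
  moreover have "E \<subseteq> (\<lambda>(u, v). {u, v}) ` (L \<times> R)"
    using assms by (fastforce simp: bipartite_graph_def)
  ultimately show "finite E"
    by (rule rev_finite_subset)
qed

text \<open>Regularity counts edges, expansion counts vertices. The map \<open>v\<close> to
  \<open>{u, v}\<close> matches the neighbours of \<open>u\<close> with the edges at
  \<open>u\<close>, which turns one count into the other.\<close>

lemma card_neighbors_singleton:
  assumes G: "bipartite_graph L R E" and "left_regular L E d" and u: "u \<in> L"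
  shows "card (neighbors R E {u}) = d"
proof -
  have "bij_betw (\<lambda>v. {u, v}) (neighbors R E {u}) {e \<in> E. u \<in> e}"
    unfolding bij_betw_def
  proof
    show "inj_on (\<lambda>v. {u, v}) (neighbors R E {u})"
      by (auto simp: inj_on_def doubleton_eq_iff)
    show "(\<lambda>v. {u, v}) ` neighbors R E {u} = {e \<in> E. u \<in> e}"
    proof
      show "{e \<in> E. u \<in> e} \<subseteq> (\<lambda>v. {u, v}) ` neighbors R E {u}"
      proof
        fix e assume e: "e \<in> {e \<in> E. u \<in> e}"
        then obtain a b where ab: "e = {a, b}" "a \<in> L" "b \<in> R"
          using G unfolding bipartite_graph_def by blast
        \<comment> \<open>The endpoint of \<open>e\<close> equal to \<open>u\<close> cannot be
          \<open>b\<close>, since \<open>L\<close> and \<open>R\<close> are disjoint.\<close>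
        moreover have "a = u"
          using e ab u G unfolding bipartite_graph_def by blast
        ultimately show "e \<in> (\<lambda>v. {u, v}) ` neighbors R E {u}"
          using e by (auto simp: neighbors_def)
      qed
    qed (auto simp: neighbors_def)
  qed
  then show ?thesis
    using assms by (simp add: bij_betw_same_card left_regular_def)
qed

lemma right_vertex_of_large_degree:
  assumes G: "bipartite_graph L R E" and reg: "left_regular L E d" and "card R \<le> card L"
  obtains v where "v \<in> R" "d \<le> card {u \<in> L. {u, v} \<in> E}"
proof (rule ccontr)
  assume "\<not> thesis"
  with that have small: "card {u \<in> L. {u, v} \<in> E} < d" if "v \<in> R" for v
    using \<open>v \<in> R\<close> not_le by blast
  note fin = bipartite_graph_finite[OF G]
  have "card L * d = (\<Sum>u\<in>L. card {v \<in> R. {u, v} \<in> E})"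
    using card_neighbors_singleton[OF G reg] by (simp add: neighbors_def)
  also have "\<dots> = (\<Sum>v\<in>R. card {u \<in> L. {u, v} \<in> E})"
    by (rule sum_multicount_gen) (use fin in auto)
  \<comment> \<open>Every summand is below \<open>d\<close>, and the sum is strictly smaller because
    \<open>R\<close> is nonempty. This contradicts
    \<open>card R * d \<le> card L * d\<close>.\<close>
  also have "\<dots> < card R * d"
    using sum_bounded_above_strict[of R "\<lambda>v. card {u \<in> L. {u, v} \<in> E}" d] small G fin
    by (auto simp: bipartite_graph_def card_gt_0_iff)
  finally show False
    using \<open>card R \<le> card L\<close> by simp
qed

text \<open>The shared vertex \<open>v\<close> is counted once for all of \<open>X\<close>; beyond
  it, each member of \<open>X\<close> contributes at most \<open>d - 1\<close> further vertices, by
  the union bound.\<close>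

lemma card_neighbors_common:
  assumes G: "bipartite_graph L R E" and reg: "left_regular L E d"
    and X: "X \<subseteq> L" and "v \<in> R" and common: "\<And>u. u \<in> X \<Longrightarrow> {u, v} \<in> E"
  shows "card (neighbors R E X) \<le> 1 + card X * (d - 1)"
proof -
  have fin: "finite X" "finite R"
    using bipartite_graph_finite[OF G] X finite_subset by auto
  have "card (neighbors R E {u} - {v}) = d - 1" if "u \<in> X" for u
  proof -
    have "v \<in> neighbors R E {u}"
      using common \<open>v \<in> R\<close> that by (simp add: neighbors_def)
    then show ?thesis
      using card_neighbors_singleton[OF G reg] X that by auto
  qed
  then have "card (\<Union>u\<in>X. neighbors R E {u} - {v}) \<le> card X * (d - 1)"
    using card_UN_le[OF fin(1), of "\<lambda>u. neighbors R E {u} - {v}"] by simp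
  moreover have "card (neighbors R E X) \<le> card (insert v (\<Union>u\<in>X. neighbors R E {u} - {v}))"
    by (rule card_mono) (use fin in \<open>auto simp: neighbors_def\<close>)
  moreover have "card (insert v (\<Union>u\<in>X. neighbors R E {u} - {v}))
      \<le> Suc (card (\<Union>u\<in>X. neighbors R E {u} - {v}))"
    by (rule card_insert_le_m1) auto
  ultimately show ?thesis
    by linarith
qed

lemma expansion_const_le:
  assumes "finite L" "X \<subseteq> L" "0 < card X" "card X \<le> t"
  shows "expansion_const L R E t \<le> real (card (neighbors R E X)) / real (card X)"
  unfolding expansion_const_def
proof (rule Min_le)
  \<comment> \<open>\<open>Min\<close> is a lower bound only on a finite set; the ratios lie in the
    image of the finite \<open>Pow L\<close>.\<close>
  show "finite {real (card (neighbors R E X)) / real (card X) | X.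
      X \<subseteq> L \<and> 0 < card X \<and> card X \<le> t}"
    by (rule finite_subset[of _ "(\<lambda>X. real (card (neighbors R E X)) / real (card X)) ` Pow L"])
      (use assms in auto)
qed (use assms in blast)

lemma expansion_const_left_regular_le:
  assumes G: "bipartite_graph L R E" and reg: "left_regular L E d" and "card R \<le> card L"
    and t: "1 \<le> t" "t \<le> d"
  shows "expansion_const L R E t \<le> (real d - 1) + 1 / real t"
proof -
  obtain v where v: "v \<in> R" "d \<le> card {u \<in> L. {u, v} \<in> E}"
    by (rule right_vertex_of_large_degree[OF G reg \<open>card R \<le> card L\<close>])
  \<comment> \<open>The restriction \<open>t \<le> d\<close> guarantees that \<open>v\<close> has
    enough neighbours to choose exactly \<open>t\<close> of them.\<close>
  have "t \<le> card {u \<in> L. {u, v} \<in> E}"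
    using t v by linarith
  then obtain X where X: "X \<subseteq> {u \<in> L. {u, v} \<in> E}" "card X = t"
    using obtain_subset_with_card_n by blast
  then have "card (neighbors R E X) \<le> 1 + t * (d - 1)"
    using card_neighbors_common[OF G reg, of X v] v by auto
  then have "real (card (neighbors R E X)) \<le> real (1 + t * (d - 1))"
    by (rule of_nat_mono)
  \<comment> \<open>The truncated difference \<open>d - 1\<close> becomes a real one because
    \<open>1 \<le> t \<le> d\<close>.\<close>
  also have "\<dots> = 1 + real t * (real d - 1)"
    using t by (simp add: of_nat_diff)
  finally have "real (card (neighbors R E X)) / real t \<le> (real d - 1) + 1 / real t"
    using t by (simp add: field_simps)
  moreover have "expansion_const L R E t \<le> real (card (neighbors R E X)) / real (card X)"
    by (rule expansion_const_le) (use X t bipartite_graph_finite[OF G] in auto)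
  ultimately show ?thesis
    using X by simp
qed

theorem lemma1p3:
  fixes L R :: "'a set" and E :: "'a set set" and d n m :: nat
  assumes "bipartite_graph L R E"
    and "left_regular L E d"
    and "d \<ge> 2"
    and "n = card L" and "m = card R"
    and "n \<ge> m"
  shows "expansion_const L R E 2 \<le> real d - 1 / 2 \<and>
         (expansion_const L R E 2 = real d - 1 / 2 \<longrightarrow>
           (\<forall>t::nat. 1 \<le> t \<and> t \<le> d \<longrightarrow>
              expansion_const L R E t \<le> (real d - 1) + 1 / real t))"
proof -
  have bound: "expansion_const L R E t \<le> (real d - 1) + 1 / real t" if "1 \<le> t" "t \<le> d" for t
    using expansion_const_left_regular_le assms that by blast
  show ?thesis
    \<comment> \<open>\<open>d \<ge> 2\<close> makes \<open>t = 2\<close> admissible, where the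
      bound reads \<open>d - 1 + 1 / 2 = d - 1 / 2\<close>.\<close>
    using bound[of 2] bound \<open>d \<ge> 2\<close> by simp
qed

end
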